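(* There is $p=O(\log^2 n)$ such that $D^{p}(\textsc{IndSub}(P_4))=\tilde O(n)$.
   Context: $P_4$ is the path on four vertices. Insertion-only streaming model: the edges of an $n$-vertex undirected input graph $G$ arrive as a stream in arbitrary order; the algorithm knows $n$, makes $p$ passes, and has $S$ bits of memory. $\textsc{IndSub}(H)$: decide whether $G$ contains $H$ as an induced subgraph and if so output the vertex set of a copy. $D^p(\Pi)$ is the minimum space of a deterministic $p$-pass streaming algorithm solving $\Pi$. $\tilde O$ hides polylogarithmic factors in $n$. *)

theory Defs
  imports Complex_Main
begin

definition graph_edges :: "nat \<Rightarrow> nat set set" where
  "graph_edges n = {e. e \<subseteq> {..<n} \<and> card e = 2}"

definition valid_graph :: "nat \<Rightarrow> nat set set \<Rightarrow> bool" where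
  "valid_graph n E \<longleftrightarrow> E \<subseteq> graph_edges n"

definition is_stream :: "nat set set \<Rightarrow> nat set list \<Rightarrow> bool" where
  "is_stream E xs \<longleftrightarrow> distinct xs \<and> set xs = E"

definition induced_P4 :: "nat set set \<Rightarrow> nat set \<Rightarrow> bool" where
  "induced_P4 E V \<longleftrightarrow> (\<exists>a b c d. distinct [a, b, c, d] \<and> V = {a, b, c, d} \<and>
     {a, b} \<in> E \<and> {b, c} \<in> E \<and> {c, d} \<in> E \<and>
     {a, c} \<notin> E \<and> {b, d} \<notin> E \<and> {a, d} \<notin> E)"

text \<open>Deterministic multi-pass streaming algorithm: memory states are the S-bit
  strings, encoded as naturals below 2^S; init is the initial memory content,
  step i e s is the new memory after reading edge e in pass i (0-based) with
  memory s; out maps the final memory to the output (None = no induced P_4).\<close>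

definition run_pass :: "(nat \<Rightarrow> nat set \<Rightarrow> nat \<Rightarrow> nat) \<Rightarrow> nat \<Rightarrow> nat \<Rightarrow> nat set list \<Rightarrow> nat" where
  "run_pass step i s xs = fold (\<lambda>e s. step i e s) xs s"

definition run_passes :: "(nat \<Rightarrow> nat set \<Rightarrow> nat \<Rightarrow> nat) \<Rightarrow> nat \<Rightarrow> nat \<Rightarrow> nat set list \<Rightarrow> nat" where
  "run_passes step p s0 xs = fold (\<lambda>i s. run_pass step i s xs) [0..<p] s0"

definition solves_IndSub_P4 ::
  "nat \<Rightarrow> nat \<Rightarrow> nat \<Rightarrow> nat \<Rightarrow> (nat \<Rightarrow> nat set \<Rightarrow> nat \<Rightarrow> nat) \<Rightarrow> (nat \<Rightarrow> nat set option) \<Rightarrow> bool" where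
  "solves_IndSub_P4 n p S init step out \<longleftrightarrow>
     init < 2 ^ S \<and>
     (\<forall>i<p. \<forall>e \<in> graph_edges n. \<forall>s < 2 ^ S. step i e s < 2 ^ S) \<and>
     (\<forall>E xs. valid_graph n E \<and> is_stream E xs \<longrightarrow>
        (case out (run_passes step p init xs) of
           None \<Rightarrow> \<not> (\<exists>V. induced_P4 E V)
         | Some V \<Rightarrow> induced_P4 E V))"

definition det_streamable_IndSub_P4 :: "nat \<Rightarrow> nat \<Rightarrow> nat \<Rightarrow> bool" where
  "det_streamable_IndSub_P4 n p S \<longleftrightarrow> (\<exists>init step out. solves_IndSub_P4 n p S init step out)"

end

theory Submission
  imports Defs
begin

text \<open>
  A graph without induced \<open>P\<^sub>4\<close> on at least two vertices, or its complement, is disconnected, so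
  there are only \<open>n\<^bsup>O(n)\<^esup>\<close> such graphs on \<open>n\<close> labelled vertices.  Hence edge weights with
  \<open>O(n log n)\<close> bits can be chosen such that distinct \<open>P\<^sub>4\<close>-free graphs have distinct total
  weights; their existence suffices, as the model is non-uniform.  One pass that sums the weights
  over the stream leaves at most one \<open>P\<^sub>4\<close>-free candidate, and a second pass checks whether
  the candidate is the input. Binary search over \<open>m\<close> with this test, applied to the subgraph
  induced on the first \<open>m\<close> vertices, finds the least \<open>m\<close> for which that subgraph
  contains a \<open>P\<^sub>4\<close>. The subgraph on the first \<open>m - 1\<close> vertices is then
  \<open>P\<^sub>4\<close>-free and can be learned in one pass, the edges at the last vertex in another, and a
  \<open>P\<^sub>4\<close> can be read off.
\<close>

section \<open>Counting graphs without induced paths on four vertices\<close>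

definition splits :: "nat set set \<Rightarrow> nat set \<Rightarrow> nat set \<Rightarrow> nat set \<Rightarrow> bool" where
  "splits E V A B \<longleftrightarrow> A \<noteq> {} \<and> B \<noteq> {} \<and> A \<inter> B = {} \<and> A \<union> B = V \<and> (\<forall>a\<in>A. \<forall>b\<in>B. {a, b} \<notin> E)"

text \<open>P4 is self-complementary: the non-edges of the path a-b-c-d form the path c-a-d-b. The
  set \<open>- E\<close> also contains sets that are not pairs, but \<open>induced_P4\<close>
  inspects only pairs.\<close>

lemma induced_P4_complement:
  assumes "induced_P4 (- E) W"
  shows "induced_P4 E W"
proof -
  obtain a b c d where *: "distinct [a, b, c, d]" "W = {a, b, c, d}"
     "{a, b} \<notin> E" "{b, c} \<notin> E" "{c, d} \<notin> E" "{a, c} \<in> E" "{b, d} \<in> E" "{a, d} \<in> E"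
    using assms unfolding induced_P4_def by auto
  show ?thesis
    unfolding induced_P4_def
    by (rule exI[of _ c], rule exI[of _ a], rule exI[of _ d], rule exI[of _ b])
      (use * in \<open>auto simp: insert_commute\<close>)
qed

text \<open>If \<open>x\<close> is adjacent to all of \<open>V\<close>, it is isolated in the
  complement. Otherwise it has a non-neighbour on one side, and either \<open>x\<close> joins that
  side or its non-neighbours there split off.\<close>

lemma splits_insert:
  assumes free: "\<not> (\<exists>W\<subseteq>insert x V. induced_P4 E W)"
    and x: "x \<notin> V" and AB: "splits E V A B"
  shows "\<exists>A B. splits E (insert x V) A B \<or> splits (- E) (insert x V) A B"
proof (cases "\<forall>v\<in>V. {x, v} \<in> E")
  case True
  then have "splits (- E) (insert x V) {x} V"
    using AB x unfolding splits_def by auto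
  then show ?thesis by blast
next
  case False
  have step: ?thesis if AB: "splits E V A B" and y: "y \<in> A" "{x, y} \<notin> E" for A B y
  proof (cases "\<exists>c\<in>B. {x, c} \<in> E")
    case False
    then have "splits E (insert x V) (insert x A) B"
      using AB x unfolding splits_def by auto
    then show ?thesis by blast
  next
    case True
    then obtain c where c: "c \<in> B" "{x, c} \<in> E" by blast
    define A0 where "A0 = {a\<in>A. {x, a} \<notin> E}"
    \<comment> \<open>An edge from \<open>a\<close> to a neighbour \<open>a'\<close> of
      \<open>x\<close> would give the induced path a-a'-x-c. So \<open>A0\<close>, which contains
      \<open>y\<close>, is cut off from everything else.\<close>
    have "{a, a'} \<notin> E" if a: "a \<in> A0" "a' \<in> A - A0" for a a'
    proof
      assume e: "{a, a'} \<in> E"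
      have V: "A \<union> B = V" "A \<inter> B = {}" "\<And>a b. a \<in> A \<Longrightarrow> b \<in> B \<Longrightarrow> {a, b} \<notin> E"
        using AB unfolding splits_def by auto
      have "distinct [a, a', x, c]"
        using a c V x unfolding A0_def by auto
      then have "induced_P4 E {a, a', x, c}"
        unfolding induced_P4_def
        by (intro exI[of _ a] exI[of _ a'] exI[of _ x] exI[of _ c])
          (use e a c V in \<open>auto simp: A0_def insert_commute\<close>)
      moreover have "{a, a', x, c} \<subseteq> insert x V"
        using a c V unfolding A0_def by auto
      ultimately show False using free by blast
    qed
    then have "splits E (insert x V) A0 (insert x (V - A0))"
      using AB x y unfolding splits_def A0_def by (auto simp: insert_commute)
    then show ?thesis by blast
  qed
  obtain y where y: "y \<in> V" "{x, y} \<notin> E" using False by blast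
  have "splits E V B A"
    using AB unfolding splits_def by (metis Int_commute Un_commute insert_commute)
  then show ?thesis
    using step[OF AB, of y] step[of B A y] y AB unfolding splits_def by auto
qed

text \<open>Induction on \<open>V\<close>, adding a vertex to a split of \<open>E\<close> or of its
  complement. The second case is the first one for \<open>- E\<close>, which is P4-free by
  self-complementarity.\<close>

lemma P4_free_splits:
  assumes "finite V" "card V \<ge> 2" "\<not> (\<exists>W\<subseteq>V. induced_P4 E W)"
  shows "\<exists>A B. splits E V A B \<or> splits (- E) V A B"
  using assms
proof (induction V rule: finite_induct)
  case empty
  then show ?case by simp
next
  case (insert x V)
  show ?case
  proof (cases "card V \<ge> 2")
    case True
    then obtain A B where "splits E V A B \<or> splits (- E) V A B"
      using insert by blast
    then show ?thesis
    proof
      assume "splits E V A B"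
      then show ?thesis using splits_insert insert by blast
    next
      assume "splits (- E) V A B"
      moreover have "\<not> (\<exists>W\<subseteq>insert x V. induced_P4 (- E) W)"
        using insert.prems induced_P4_complement by blast
      ultimately have "\<exists>A B. splits (- E) (insert x V) A B \<or> splits (- (- E)) (insert x V) A B"
        using splits_insert insert.hyps by blast
      then show ?thesis by auto
    qed
  next
    case False
    then have "card V = 1" using insert by simp
    then obtain y where "V = {y}" using card_1_singletonE by blast
    then have "splits E (insert x V) {x} {y} \<or> splits (- E) (insert x V) {x} {y}"
      using insert unfolding splits_def by auto
    then show ?thesis by blast
  qed
qed

text \<open>
  A stack machine for postfix terms over vertices, disjoint union and join: the tokens 0 and 1 are
  the two operations, and \<open>v + 2\<close> is the one-vertex graph on \<open>v\<close>.
\<close>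

fun cograph_exec :: "nat \<Rightarrow> (nat set \<times> nat set set) list \<Rightarrow> (nat set \<times> nat set set) list" where
  "cograph_exec (Suc (Suc v)) st = ({v}, {}) # st"
| "cograph_exec t ((A, E) # (B, F) # st) =
     (A \<union> B, E \<union> F \<union> (if t = 0 then {} else {{a, b} |a b. a \<in> A \<and> b \<in> B})) # st"
| "cograph_exec t st = st"

text \<open>Every vertex of the path lies on one of its edges, so the whole path lies in
  \<open>A\<close>, where deleting edges that leave \<open>A\<close> changes nothing.\<close>

lemma induced_P4_subgraph:
  assumes "induced_P4 {e\<in>E. e \<subseteq> A} W"
  shows "induced_P4 E W" "W \<subseteq> A"
proof -
  obtain a b c d where *: "distinct [a, b, c, d]" "W = {a, b, c, d}"
     "{a, b} \<in> E" "{b, c} \<in> E" "{c, d} \<in> E" "{a, b} \<subseteq> A" "{c, d} \<subseteq> A"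
     "{a, c} \<notin> {e\<in>E. e \<subseteq> A}" "{b, d} \<notin> {e\<in>E. e \<subseteq> A}" "{a, d} \<notin> {e\<in>E. e \<subseteq> A}"
    using assms unfolding induced_P4_def by (elim exE conjE) simp
  then show "W \<subseteq> A" by simp
  have "{a, c} \<notin> E" "{b, d} \<notin> E" "{a, d} \<notin> E" using * by simp_all
  then show "induced_P4 E W" unfolding induced_P4_def using *(1-5) by blast
qed

text \<open>Recursion along splits yields a term with one leaf per vertex and
  \<open>card V - 1\<close> binary operations, hence the length. The arbitrary stack
  \<open>st\<close> lets the two subterms run one after the other.\<close>

lemma P4_free_cograph_exec:
  assumes "finite V" "V \<noteq> {}" "V \<subseteq> {..<n}" "\<And>e. e \<in> E \<Longrightarrow> e \<subseteq> V \<and> card e = 2"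
    "\<not> (\<exists>W. induced_P4 E W)"
  shows "\<exists>xs. Suc (length xs) = 2 * card V \<and> set xs \<subseteq> {..<n + 2} \<and>
           (\<forall>st. fold cograph_exec xs st = (V, E) # st)"
  using assms
proof (induction "card V" arbitrary: V E rule: less_induct)
  case less
  show ?case
  proof (cases "card V \<ge> 2")
    case False
    then have "card V = 1"
      using less.prems(1,2) card_gt_0_iff[of V] by linarith
    then obtain v where v: "V = {v}" using card_1_singletonE by blast
    have "e \<notin> E" for e
    proof
      assume "e \<in> E"
      then have "card e \<le> card V" "card e = 2"
        using less.prems(1,4) card_mono by blast+
      then show False using v by simp
    qed
    then have "E = {}" by blast
    then show ?thesis
      using v less.prems by (intro exI[of _ "[Suc (Suc v)]"]) auto
  next
    case True
    define join :: "nat set \<Rightarrow> nat set \<Rightarrow> bool \<Rightarrow> nat set set" where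
      "join = (\<lambda>A B j. if j then {{a, b} |a b. a \<in> A \<and> b \<in> B} else {})"
    have "\<not> (\<exists>W\<subseteq>V. induced_P4 E W)"
      using less.prems by blast
    then obtain A B j where AB: "splits (if j then - E else E) V A B"
      using P4_free_splits[of V E] less.prems(1) True by (metis (full_types))
    have V: "A \<union> B = V" "A \<inter> B = {}" "A \<noteq> {}" "B \<noteq> {}"
      using AB unfolding splits_def by blast+
    have fin: "finite A" "finite B" using V(1) less.prems(1) by auto
    have card: "card V = card A + card B"
      using V fin card_Un_disjoint by blast
    have pos: "card A > 0" "card B > 0" using V fin by (auto simp: card_gt_0_iff)
    have part: "\<exists>xs. Suc (length xs) = 2 * card C \<and> set xs \<subseteq> {..<n + 2} \<and>
           (\<forall>st. fold cograph_exec xs st = (C, {e\<in>E. e \<subseteq> C}) # st)" if "C = A \<or> C = B" for C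
    proof (rule less.hyps)
      show "card C < card V" using that card pos by auto
      show "finite C" "C \<noteq> {}" "C \<subseteq> {..<n}" using that V fin less.prems(3) by auto
      show "\<And>e. e \<in> {e\<in>E. e \<subseteq> C} \<Longrightarrow> e \<subseteq> C \<and> card e = 2" using less.prems(4) by blast
      show "\<not> (\<exists>W. induced_P4 {e\<in>E. e \<subseteq> C} W)"
        using less.prems(5) induced_P4_subgraph(1) by blast
    qed
    obtain xs ys where xs: "Suc (length xs) = 2 * card A" "set xs \<subseteq> {..<n + 2}"
        "\<And>st. fold cograph_exec xs st = (A, {e\<in>E. e \<subseteq> A}) # st"
      and ys: "Suc (length ys) = 2 * card B" "set ys \<subseteq> {..<n + 2}"
        "\<And>st. fold cograph_exec ys st = (B, {e\<in>E. e \<subseteq> B}) # st"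
      using part[of A] part[of B] by auto
    have "E = {e\<in>E. e \<subseteq> A} \<union> {e\<in>E. e \<subseteq> B} \<union> join A B j"
    proof (intro equalityI subsetI)
      fix e assume e: "e \<in> E"
      then have e2: "e \<subseteq> V" "card e = 2" using less.prems(4) by blast+
      then obtain u v where uv: "e = {u, v}" by (auto simp: card_2_iff)
      show "e \<in> {e\<in>E. e \<subseteq> A} \<union> {e\<in>E. e \<subseteq> B} \<union> join A B j"
      proof (cases "e \<subseteq> A \<or> e \<subseteq> B")
        case True
        then show ?thesis using e by blast
      next
        case False
        then obtain a b where ab: "a \<in> A" "b \<in> B" "e = {a, b}"
          using uv e2(1) V(1) by blast
        then have "j" using e AB unfolding splits_def by (auto split: if_splits)
        then show ?thesis using ab unfolding join_def by auto
      qed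
    next
      fix e assume "e \<in> {e\<in>E. e \<subseteq> A} \<union> {e\<in>E. e \<subseteq> B} \<union> join A B j"
      then show "e \<in> E"
        using AB unfolding splits_def join_def by (auto split: if_splits)
    qed
    \<comment> \<open>The part on \<open>B\<close> is pushed last and is on top of the stack, so the
      machine sees the operands in swapped order.\<close>
    moreover have "join A B j = join B A j"
      unfolding join_def by (auto simp: insert_commute)
    ultimately have E: "E = {e\<in>E. e \<subseteq> B} \<union> {e\<in>E. e \<subseteq> A} \<union> join B A j"
      by (simp only: Un_commute)
    have j: "of_bool j < n + 2" by (simp add: of_bool_def)
    have "fold cograph_exec (xs @ ys @ [of_bool j]) st = (V, E) # st" for st
    proof -
      have "fold cograph_exec (xs @ ys @ [of_bool j]) st =
          (B \<union> A, {e\<in>E. e \<subseteq> B} \<union> {e\<in>E. e \<subseteq> A} \<union> join B A j) # st"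
        by (cases j) (simp_all add: xs(3) ys(3) join_def)
      then show ?thesis using V(1) E by (simp add: Un_commute)
    qed
    then show ?thesis
      using xs(1,2) ys(1,2) card j
      by (intro exI[of _ "xs @ ys @ [of_bool j]"]) auto
  qed
qed

section \<open>The number of labelled P4-free graphs\<close>

definition P4_free_graphs :: "nat \<Rightarrow> nat set set set" where
  "P4_free_graphs n = {E. valid_graph n E \<and> \<not> (\<exists>W. induced_P4 E W)}"

lemma finite_graph_edges: "finite (graph_edges n)"
  unfolding graph_edges_def by simp

lemma card_graph_edges: "card (graph_edges n) \<le> n\<^sup>2"
proof -
  have "graph_edges n \<subseteq> (\<lambda>(a, b). {a, b}) ` ({..<n} \<times> {..<n})"
  proof
    fix e assume "e \<in> graph_edges n"
    then obtain a b where "e = {a, b}" "a < n" "b < n"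
      unfolding graph_edges_def by (auto simp: card_2_iff)
    then show "e \<in> (\<lambda>(a, b). {a, b}) ` ({..<n} \<times> {..<n})" by force
  qed
  then have "card (graph_edges n) \<le> card ({..<n} \<times> {..<n})"
    by (meson surj_card_le finite_SigmaI finite_lessThan)
  then show ?thesis by (simp add: power2_eq_square)
qed

lemma finite_P4_free_graphs: "finite (P4_free_graphs n)"
  by (rule finite_subset[of _ "Pow (graph_edges n)"])
    (auto simp: P4_free_graphs_def valid_graph_def finite_graph_edges)

text \<open>Each such graph is the result of some token list of length \<open>2 * n - 1\<close> over
  \<open>n + 2\<close> tokens, so counting these lists suffices.\<close>

lemma card_P4_free_graphs:
  assumes "n > 0"
  shows "card (P4_free_graphs n) \<le> (n + 2) ^ (2 * n)"
proof -
  let ?L = "{xs. set xs \<subseteq> {..<n + 2} \<and> length xs = 2 * n - 1}"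
  have "E \<in> (\<lambda>xs. snd (hd (fold cograph_exec xs []))) ` ?L" if "E \<in> P4_free_graphs n" for E
  proof -
    have "\<exists>xs. Suc (length xs) = 2 * card {..<n} \<and> set xs \<subseteq> {..<n + 2} \<and>
           (\<forall>st. fold cograph_exec xs st = ({..<n}, E) # st)"
      by (rule P4_free_cograph_exec)
        (use that assms in \<open>auto simp: P4_free_graphs_def valid_graph_def graph_edges_def\<close>)
    then obtain xs where "Suc (length xs) = 2 * n" "set xs \<subseteq> {..<n + 2}"
        "fold cograph_exec xs [] = ({..<n}, E) # []"
      by auto
    then show ?thesis by (intro image_eqI[of _ _ xs]) auto
  qed
  then have "card (P4_free_graphs n) \<le> card ?L"
    by (intro surj_card_le[of _ _ "\<lambda>xs. snd (hd (fold cograph_exec xs []))"])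
      (auto intro: finite_lists_length_eq)
  also have "\<dots> = (n + 2) ^ (2 * n - 1)"
    using card_lists_length_eq[of "{..<n + 2}" "2 * n - 1"] by simp
  also have "\<dots> \<le> (n + 2) ^ (2 * n)"
    by (rule power_increasing) auto
  finally show ?thesis .
qed

section \<open>Weights with distinct subset sums\<close>

text \<open>The weights are chosen greedily, avoiding all differences of the sums formed so far.\<close>

lemma ex_inj_on_sum:
  assumes "finite U" "\<F> \<subseteq> Pow U"
  shows "\<exists>w::'a \<Rightarrow> nat. (\<forall>e. w e \<le> (card \<F>)\<^sup>2) \<and> inj_on (sum w) \<F>"
  using assms
proof (induction U arbitrary: \<F> rule: finite_induct)
  case empty
  then show ?case by (intro exI[of _ "\<lambda>_. 0"]) (auto simp: inj_on_def)
next
  case (insert e U)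
  let ?G = "(\<lambda>A. A - {e}) ` \<F>"
  have fin: "finite \<F>" "finite ?G"
    using insert.prems insert.hyps(1) by (auto intro: finite_subset)
  have "?G \<subseteq> Pow U" using insert.prems by auto
  then obtain w where w: "\<And>e. w e \<le> (card ?G)\<^sup>2" "inj_on (sum w) ?G"
    using insert.IH by blast
  have le: "card ?G \<le> card \<F>" using fin(1) by (rule card_image_le)
  \<comment> \<open>At most \<open>(card \<F>)\<^sup>2\<close> differences are to be avoided, one
    fewer than there are candidates for the new weight. Both orders of a pair occur, so truncated
    subtraction loses no difference.\<close>
  let ?B = "(\<lambda>(A, B). sum w A - sum w B) ` (?G \<times> ?G)"
  have "card ?B \<le> card (?G \<times> ?G)" using fin by (intro card_image_le) simp
  also have "\<dots> \<le> (card \<F>)\<^sup>2"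
    using le by (simp add: card_cartesian_product power2_eq_square mult_mono)
  finally have "card ?B < card {..(card \<F>)\<^sup>2}" by simp
  then obtain x where x: "x \<le> (card \<F>)\<^sup>2" "x \<notin> ?B"
    using card_mono[of ?B "{..(card \<F>)\<^sup>2}"] fin(2)
    by (metis atMost_iff finite_cartesian_product finite_imageI linorder_not_less subsetI)
  let ?w = "w(e := x)"
  have sum: "sum ?w A = sum w (A - {e}) + (if e \<in> A then x else 0)" if "A \<in> \<F>" for A
  proof -
    have A: "finite A" using that insert.prems insert.hyps(1) by (meson PowD finite.insertI finite_subset subsetD)
    have "sum ?w (A - {e}) = sum w (A - {e})" by (rule sum.cong) auto
    then show ?thesis using A by (cases "e \<in> A") (simp_all add: sum.remove)
  qed
  \<comment> \<open>Sums of two sets of which only one contains \<open>e\<close> cannot agree: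
    \<open>x\<close> would be an avoided difference.\<close>
  have apart: "sum w (A - {e}) + x \<noteq> sum w (B - {e})" if "A \<in> \<F>" "B \<in> \<F>" for A B
  proof
    assume "sum w (A - {e}) + x = sum w (B - {e})"
    then have "x = sum w (B - {e}) - sum w (A - {e})" by linarith
    then show False using x(2) that by force
  qed
  have "inj_on (sum ?w) \<F>"
  proof (rule inj_onI)
    fix A B assume AB: "A \<in> \<F>" "B \<in> \<F>" "sum ?w A = sum ?w B"
    have "e \<in> A \<longleftrightarrow> e \<in> B"
      using AB(3) apart[OF AB(1,2)] apart[OF AB(2,1)]
      unfolding sum[OF AB(1)] sum[OF AB(2)] by (auto split: if_splits)
    moreover from this have "sum w (A - {e}) = sum w (B - {e})"
      using AB(3) unfolding sum[OF AB(1)] sum[OF AB(2)] by auto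
    then have "A - {e} = B - {e}"
      using inj_onD[OF w(2)] AB by blast
    ultimately show "A = B" by blast
  qed
  moreover have "?w e' \<le> (card \<F>)\<^sup>2" for e'
    using x(1) order_trans[OF w(1)[of e'] power_mono[OF le, of 2]] by simp
  ultimately show ?case by blast
qed

section \<open>Adaptive weighted-sum queries\<close>

text \<open>
  A query asks for the total weight of the input under some edge weights; \<open>p\<close> bounds the number of
  queries, \<open>b\<close> the bits of an answer, and \<open>X\<close> holds the inputs consistent with the answers so far.
\<close>

primrec determined :: "nat \<Rightarrow> nat \<Rightarrow> nat set set set \<Rightarrow> (nat set set \<Rightarrow> 'a) \<Rightarrow> bool" where
  "determined b 0 X f \<longleftrightarrow> (\<exists>c. \<forall>E\<in>X. f E = c)"
| "determined b (Suc p) X f \<longleftrightarrow> (\<exists>w::nat set \<Rightarrow> nat. (\<forall>E\<in>X. sum w E < 2 ^ b) \<and>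
     (\<forall>a. determined b p {E\<in>X. sum w E = a} f))"

lemma determined_subset:
  assumes "determined b p Y f" "X \<subseteq> Y"
  shows "determined b p X f"
  using assms
proof (induction p arbitrary: X Y)
  case 0
  then show ?case by auto
next
  case (Suc p)
  then obtain w :: "nat set \<Rightarrow> nat" where w: "\<forall>E\<in>Y. sum w E < 2 ^ b" "\<And>a. determined b p {E\<in>Y. sum w E = a} f"
    by auto
  have "determined b p {E\<in>X. sum w E = a} f" for a
    using Suc.IH[OF w(2)[of a], of "{E\<in>X. sum w E = a}"] Suc.prems(2) by blast
  then show ?case using w(1) Suc.prems(2) by auto
qed

lemma determined_0_I:
  assumes "\<And>E E'. E \<in> X \<Longrightarrow> E' \<in> X \<Longrightarrow> f E = f E'"
  shows "determined b 0 X f"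
proof (cases "X = {}")
  case False
  then obtain E where "E \<in> X" by blast
  then show ?thesis
    unfolding determined.simps by (intro exI[of _ "f E"] ballI assms)
qed simp

text \<open>Queries of weight zero serve as padding, so that all branches can use the same number of
  queries.\<close>

lemma determined_const:
  assumes "\<And>E. E \<in> X \<Longrightarrow> f E = c"
  shows "determined b p X f"
  using assms
proof (induction p arbitrary: X)
  case 0
  then show ?case by auto
next
  case (Suc p)
  have "determined b p {E\<in>X. sum (\<lambda>_. 0) E = a} f" for a :: nat
    using Suc.prems by (intro Suc.IH) blast
  moreover have "sum (\<lambda>_. 0) E < (2::nat) ^ b" for E :: "nat set set"
    by simp
  ultimately show ?case unfolding determined.simps by blast
qed

text \<open>Sequential composition: the queries for \<open>g\<close> may be chosen in view of the
  value \<open>c\<close> already found for \<open>f\<close>.\<close>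

lemma determined_bind:
  assumes "determined b p X f" "\<And>c. determined b q {E\<in>X. f E = c} g"
  shows "determined b (p + q) X g"
  using assms
proof (induction p arbitrary: X)
  case 0
  then obtain c where "\<forall>E\<in>X. f E = c" by auto
  then have "{E\<in>X. f E = c} = X" by blast
  then show ?case using 0(2)[of c] by simp
next
  case (Suc p)
  then obtain w :: "nat set \<Rightarrow> nat" where w: "\<forall>E\<in>X. sum w E < 2 ^ b" "\<And>a. determined b p {E\<in>X. sum w E = a} f"
    by auto
  have "determined b q {E \<in> {E\<in>X. sum w E = a}. f E = c} g" for a c
    by (rule determined_subset[OF Suc.prems(2)[of c]]) blast
  then have "determined b (p + q) {E\<in>X. sum w E = a} g" for a
    using Suc.IH[OF w(2)] by blast
  then show ?case using w(1) by auto
qed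

text \<open>Reducing modulo \<open>M\<close> keeps the memory bounded on every input, as the model
  demands, and does no harm to sums below \<open>M\<close>.\<close>

lemma fold_add_sum:
  fixes w :: "'a \<Rightarrow> nat"
  assumes "distinct xs"
  shows "fold (\<lambda>e s. (s + w e) mod M) xs s mod M = (s + sum w (set xs)) mod M"
  using assms
proof (induction xs arbitrary: s)
  case (Cons x xs)
  then have "fold (\<lambda>e s. (s + w e) mod M) (x # xs) s mod M = ((s + w x) mod M + sum w (set xs)) mod M"
    by simp
  also have "\<dots> = (s + sum w (set (x # xs))) mod M"
    using Cons.prems by (simp add: mod_add_left_eq add.assoc)
  finally show ?case .
qed simp

text \<open>
  The memory holds the answers as digits in base \<open>2 ^ b\<close>, the first answer being the least
  significant digit.
\<close>

lemma determined_streamable: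
  assumes "determined b p X f"
  shows "\<exists>step out. (\<forall>i e s. s < 2 ^ (p * b) \<longrightarrow> step i e s < 2 ^ (p * b)) \<and>
    (\<forall>E\<in>X. \<forall>xs. is_stream E xs \<longrightarrow> out (run_passes step p 0 xs) = f E)"
  using assms
proof (induction p arbitrary: X)
  case 0
  then obtain c where "\<forall>E\<in>X. f E = c" by auto
  then show ?case
    by (intro exI[of _ "\<lambda>i e s. s"] exI[of _ "\<lambda>_. c"]) simp
next
  case (Suc p)
  let ?M = "2 ^ b :: nat"
  have M: "?M > 0" by simp
  obtain w :: "nat set \<Rightarrow> nat" where w: "\<forall>E\<in>X. sum w E < ?M" "\<And>a. determined b p {E\<in>X. sum w E = a} f"
    using Suc.prems by auto
  obtain st ou where
    st: "\<And>a i e s. s < 2 ^ (p * b) \<Longrightarrow> st a i e s < 2 ^ (p * b)" and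
    ou: "\<And>a E xs. E \<in> X \<Longrightarrow> sum w E = a \<Longrightarrow> is_stream E xs \<Longrightarrow>
           ou a (run_passes (st a) p 0 xs) = f E"
  \<comment> \<open>The algorithm for the remaining queries depends on the first answer
    \<open>a\<close>, so one is chosen for every \<open>a\<close>.\<close>
  proof -
    let ?P = "\<lambda>a step out. (\<forall>i e s. s < 2 ^ (p * b) \<longrightarrow> step i e s < 2 ^ (p * b)) \<and>
      (\<forall>E\<in>{E\<in>X. sum w E = a}. \<forall>xs. is_stream E xs \<longrightarrow> out (run_passes step p 0 xs) = f E)"
    have "\<exists>g. \<forall>a. \<exists>h. ?P a (g a) h"
      by (rule choice) (use Suc.IH w(2) in blast)
    then obtain g where "\<forall>a. \<exists>h. ?P a (g a) h" by blast
    then have "\<exists>h. \<forall>a. ?P a (g a) (h a)" by (rule choice)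
    then obtain h where gh: "\<And>a. ?P a (g a) (h a)" by blast
    show ?thesis by (rule that[of g h]) (use gh in blast)+
  qed
  \<comment> \<open>Pass 0 computes the first answer. Pass \<open>Suc j\<close> preserves it as the
    low digit and simulates pass \<open>j\<close> of the algorithm chosen for it on the
    quotient.\<close>
  define step where "step = (\<lambda>i e s. case i of 0 \<Rightarrow> (s + w e) mod ?M
     | Suc j \<Rightarrow> s mod ?M + ?M * st (s mod ?M) j e (s div ?M))"
  define out where "out = (\<lambda>s. ou (s mod ?M) (s div ?M))"
  have "step i e s < 2 ^ (Suc p * b)" if s: "s < 2 ^ (Suc p * b)" for i e s
  proof (cases i)
    case 0
    have "(s + w e) mod ?M < ?M" by simp
    also have "\<dots> \<le> 2 ^ (Suc p * b)" by (rule power_increasing) auto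
    finally show ?thesis using 0 unfolding step_def by simp
  next
    case (Suc j)
    have pow: "2 ^ (Suc p * b) = ?M * 2 ^ (p * b)" by (simp add: power_add)
    have "s div ?M < 2 ^ (p * b)"
      using s unfolding pow by (intro less_mult_imp_div_less) (simp only: mult.commute)
    then have "st (s mod ?M) j e (s div ?M) < 2 ^ (p * b)" by (rule st)
    then have "Suc (st (s mod ?M) j e (s div ?M)) \<le> 2 ^ (p * b)" by simp
    then have "?M * Suc (st (s mod ?M) j e (s div ?M)) \<le> 2 ^ (Suc p * b)"
      unfolding pow by (rule mult_le_mono2)
    moreover have "s mod ?M + ?M * x < ?M * Suc x" for x by simp
    ultimately have "s mod ?M + ?M * st (s mod ?M) j e (s div ?M) < 2 ^ (Suc p * b)"
      by (rule less_le_trans[rotated])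
    then show ?thesis using Suc unfolding step_def by simp
  qed
  moreover have "out (run_passes step (Suc p) 0 xs) = f E" if E: "E \<in> X" "is_stream E xs" for E xs
  proof -
    let ?a = "sum w E"
    have a: "?a < ?M" using w(1) E(1) by blast
    have xs: "distinct xs" "set xs = E" using E(2) unfolding is_stream_def by auto
    have "fold (\<lambda>e s. (s + w e) mod ?M) ys s < ?M" if "s < ?M" for s ys
      using that by (induction ys arbitrary: s) auto
    then have first: "run_pass step 0 0 xs = ?a"
      using fold_add_sum[OF xs(1), of w ?M 0] a xs(2)
      unfolding run_pass_def step_def by simp
    have pass: "fold (step (Suc j)) ys (?a + ?M * s) = ?a + ?M * fold (st ?a j) ys s" for j s ys
      using a by (induction ys arbitrary: s) (simp_all add: step_def)
    have rest: "fold (\<lambda>i s. run_pass step i s xs) (map Suc is) (?a + ?M * s) =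
        ?a + ?M * fold (\<lambda>i s. run_pass (st ?a) i s xs) is s" for "is" s
      by (induction "is" arbitrary: s) (simp_all add: run_pass_def pass)
    have "[0..<Suc p] = 0 # map Suc [0..<p]"
      by (simp add: map_Suc_upt upt_conv_Cons)
    then have "run_passes step (Suc p) 0 xs = ?a + ?M * run_passes (st ?a) p 0 xs"
      using first rest[of "[0..<p]" 0] unfolding run_passes_def by simp
    then show ?thesis using ou[OF E(1) refl E(2)] a unfolding out_def by simp
  qed
  ultimately show ?case by blast
qed

section \<open>Finding an induced path\<close>

text \<open>
  Enough bits for the weights of \<open>ex_inj_on_sum\<close> on the \<open>P\<^sub>4\<close>-free graphs and on the stars, and for
  a query that tests equality with a given graph.
\<close>

definition enough_bits :: "nat \<Rightarrow> nat \<Rightarrow> bool" where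
  "enough_bits n b \<longleftrightarrow> n\<^sup>2 * (card (P4_free_graphs n))\<^sup>2 < 2 ^ b \<and> n\<^sup>2 * (2 ^ n)\<^sup>2 < (2::nat) ^ b \<and>
     n\<^sup>2 * Suc (n\<^sup>2) < 2 ^ b"

lemma sum_le_square_mult:
  fixes w :: "nat set \<Rightarrow> nat"
  assumes "valid_graph n E" "\<And>e. w e \<le> B"
  shows "sum w E \<le> n\<^sup>2 * B"
proof -
  have "sum w E \<le> card E * B"
    using sum_bounded_above[of E w B] assms(2) by simp
  also have "card E \<le> n\<^sup>2"
    using card_mono[OF finite_graph_edges] card_graph_edges assms(1)
    unfolding valid_graph_def by (meson le_trans)
  finally show ?thesis by simp
qed

lemma sum_restrict_valid:
  fixes w :: "nat set \<Rightarrow> nat"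
  assumes "valid_graph n E"
  shows "sum (\<lambda>e. if e \<in> U then w e else 0) E = sum w (E \<inter> U)"
  using sum.inter_restrict[of E w U] finite_subset[OF _ finite_graph_edges] assms
  unfolding valid_graph_def by metis

text \<open>Weights vanish off \<open>U\<close>, so a query sees only \<open>E \<inter> U\<close>.
  The bound must cover all valid graphs, since the restriction of the input may lie outside
  \<open>\<F>\<close>.\<close>

lemma ex_restricted_weights:
  assumes "finite \<F>" "\<F> \<subseteq> Pow (graph_edges n)" "n\<^sup>2 * (card \<F>)\<^sup>2 < 2 ^ b"
  obtains w :: "nat set \<Rightarrow> nat" where
    "inj_on (sum w) \<F>"
    "\<And>E. valid_graph n E \<Longrightarrow> sum (\<lambda>e. if e \<in> U then w e else 0) E < 2 ^ b"
proof -
  obtain w where w: "\<And>e. w e \<le> (card \<F>)\<^sup>2" "inj_on (sum w) \<F>"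
    using ex_inj_on_sum[OF finite_graph_edges assms(2)] by blast
  have "sum (\<lambda>e. if e \<in> U then w e else 0) E \<le> n\<^sup>2 * (card \<F>)\<^sup>2" if "valid_graph n E" for E
    using that w(1) by (intro sum_le_square_mult) auto
  then have "sum (\<lambda>e. if e \<in> U then w e else 0) E < 2 ^ b" if "valid_graph n E" for E
    using assms(3) that by (meson le_less_trans)
  then show ?thesis using that w(2) by blast
qed

lemma determined_restriction:
  assumes "finite \<F>" "\<F> \<subseteq> Pow (graph_edges n)" "n\<^sup>2 * (card \<F>)\<^sup>2 < 2 ^ b"
    and X: "\<And>E. E \<in> X \<Longrightarrow> valid_graph n E" "\<And>E. E \<in> X \<Longrightarrow> E \<inter> U \<in> \<F>"
  shows "determined b 1 X (\<lambda>E. E \<inter> U)"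
proof -
  obtain w :: "nat set \<Rightarrow> nat" where w: "inj_on (sum w) \<F>"
    "\<And>E. valid_graph n E \<Longrightarrow> sum (\<lambda>e. if e \<in> U then w e else 0) E < 2 ^ b"
    using ex_restricted_weights[OF assms(1-3)] by blast
  let ?X = "\<lambda>a. {E\<in>X. sum (\<lambda>e. if e \<in> U then w e else 0) E = a}"
  have "determined b 0 (?X a) (\<lambda>E. E \<inter> U)" for a
  proof -
    have "E \<inter> U = E' \<inter> U" if "E \<in> X" "E' \<in> X"
      "sum (\<lambda>e. if e \<in> U then w e else 0) E = a" "sum (\<lambda>e. if e \<in> U then w e else 0) E' = a" for E E'
      using that X sum_restrict_valid[OF X(1), of E U w] sum_restrict_valid[OF X(1), of E' U w]
      by (intro inj_onD[OF w(1)]) simp_all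
    then show ?thesis
      by (intro determined_0_I) blast
  qed
  then show ?thesis
    using w(2) X(1) by (simp only: One_nat_def determined.simps(2)) blast
qed

text \<open>Edges of \<open>H\<close> weigh 1 and other edges of \<open>U\<close> weigh
  \<open>Suc (n\<^sup>2)\<close>, more than \<open>card H\<close>. Hence the total is
  \<open>card H\<close> exactly if all of \<open>H\<close> and nothing else from \<open>U\<close> is
  present.\<close>

lemma determined_eq_graph:
  assumes "enough_bits n b" "H \<subseteq> U" "valid_graph n H"
    and X: "\<And>E. E \<in> X \<Longrightarrow> valid_graph n E"
  shows "determined b 1 X (\<lambda>E. E \<inter> U = H)"
proof -
  let ?w = "\<lambda>e. if e \<in> H then 1 else if e \<in> U then Suc (n\<^sup>2) else 0 :: nat"
  have eq: "E \<inter> U = H \<longleftrightarrow> sum ?w E = card H" if "E \<in> X" for E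
  proof -
    have fin: "finite E" "finite H"
      using X[OF that] assms(3) finite_subset[OF _ finite_graph_edges]
      unfolding valid_graph_def by blast+
    have H: "card H \<le> n\<^sup>2"
      using card_mono[OF finite_graph_edges] card_graph_edges assms(3)
      unfolding valid_graph_def by (meson le_trans)
    have "sum ?w E = sum ?w (E \<inter> H) + sum ?w (E - H)"
      using fin(1) by (rule sum.Int_Diff)
    also have "sum ?w (E \<inter> H) = card (E \<inter> H)" by simp
    also have "sum ?w (E - H) = (\<Sum>e\<in>E - H. if e \<in> U then Suc (n\<^sup>2) else 0)"
      by (rule sum.cong) auto
    also have "\<dots> = (\<Sum>e\<in>(E - H) \<inter> U. Suc (n\<^sup>2))"
      using fin(1) by (intro sum.inter_restrict[symmetric]) simp
    also have "\<dots> = card ((E - H) \<inter> U) * Suc (n\<^sup>2)" by simp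
    finally have sum: "sum ?w E = card (E \<inter> H) + card ((E - H) \<inter> U) * Suc (n\<^sup>2)" .
    show ?thesis
    proof
      assume "E \<inter> U = H"
      then have "E \<inter> H = H" "(E - H) \<inter> U = {}" by auto
      then show "sum ?w E = card H" using sum by simp
    next
      assume eq: "sum ?w E = card H"
      have "card ((E - H) \<inter> U) = 0"
      proof (rule ccontr)
        assume "card ((E - H) \<inter> U) \<noteq> 0"
        then have "1 * Suc (n\<^sup>2) \<le> card ((E - H) \<inter> U) * Suc (n\<^sup>2)"
          by (intro mult_le_mono1) simp
        then show False using sum eq H by simp
      qed
      then have "(E - H) \<inter> U = {}" "card (E \<inter> H) = card H"
        using fin sum eq by simp_all
      then have "E \<inter> H = H" using fin card_subset_eq[of H "E \<inter> H"] by blast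
      then show "E \<inter> U = H" using \<open>(E - H) \<inter> U = {}\<close> assms(2) by blast
    qed
  qed
  have "sum ?w E < 2 ^ b" if "E \<in> X" for E
  proof -
    have "sum ?w E \<le> n\<^sup>2 * Suc (n\<^sup>2)"
      using X[OF that] by (intro sum_le_square_mult) auto
    also have "\<dots> < 2 ^ b" using assms(1) unfolding enough_bits_def by blast
    finally show ?thesis .
  qed
  moreover have "determined b 0 {E\<in>X. sum ?w E = a} (\<lambda>E. E \<inter> U = H)" for a
    using eq by (intro determined_const[where c = "a = card H"]) auto
  ultimately show ?thesis
    by (simp only: One_nat_def determined.simps(2)) blast
qed

section \<open>Testing initial segments of the vertices and binary search\<close>

definition P4_below :: "nat set set \<Rightarrow> nat \<Rightarrow> bool" where
  "P4_below E m \<longleftrightarrow> (\<exists>W\<subseteq>{..<m}. induced_P4 E W)"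

lemma induced_P4_restrict:
  assumes "valid_graph n E"
  shows "induced_P4 (E \<inter> graph_edges m) W \<longleftrightarrow> induced_P4 E W \<and> W \<subseteq> {..<m}"
proof -
  have "E \<inter> graph_edges m = {e\<in>E. e \<subseteq> {..<m}}"
    using assms unfolding valid_graph_def graph_edges_def by auto
  moreover have "induced_P4 {e\<in>E. e \<subseteq> {..<m}} W" if "induced_P4 E W" "W \<subseteq> {..<m}"
    using that unfolding induced_P4_def by fastforce
  ultimately show ?thesis using induced_P4_subgraph[of E "{..<m}" W] by auto
qed

lemma P4_free_restrict:
  assumes "valid_graph n E"
  shows "E \<inter> graph_edges m \<in> P4_free_graphs n \<longleftrightarrow> \<not> P4_below E m"
  using assms induced_P4_restrict[OF assms]
  unfolding P4_free_graphs_def P4_below_def valid_graph_def by auto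

text \<open>The first answer leaves at most one P4-free candidate \<open>H\<close> for the
  restriction, because the sums are injective; the second query tests whether the restriction equals
  \<open>H\<close>.\<close>

lemma determined_P4_below:
  assumes b: "enough_bits n b" and X: "\<And>E. E \<in> X \<Longrightarrow> valid_graph n E"
  shows "determined b 2 X (\<lambda>E. P4_below E m)"
proof -
  let ?F = "{H\<in>P4_free_graphs n. H \<subseteq> graph_edges m}" and ?U = "graph_edges m"
  have F: "finite (P4_free_graphs n)" "P4_free_graphs n \<subseteq> Pow (graph_edges n)"
    using finite_P4_free_graphs by (auto simp: P4_free_graphs_def valid_graph_def)
  obtain w :: "nat set \<Rightarrow> nat" where w: "inj_on (sum w) (P4_free_graphs n)"
    "\<And>E. valid_graph n E \<Longrightarrow> sum (\<lambda>e. if e \<in> ?U then w e else 0) E < 2 ^ b"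
    using ex_restricted_weights[OF F] b unfolding enough_bits_def by blast
  have "determined b 1 {E\<in>X. sum (\<lambda>e. if e \<in> ?U then w e else 0) E = a} (\<lambda>E. P4_below E m)" for a
  proof -
    let ?X = "{E\<in>X. sum (\<lambda>e. if e \<in> ?U then w e else 0) E = a}"
    have cand: "E \<inter> ?U \<in> ?F \<and> sum w (E \<inter> ?U) = a" if "E \<in> ?X" "\<not> P4_below E m" for E
      using that X P4_free_restrict[of n E m] sum_restrict_valid[of n E ?U w] by auto
    show ?thesis
    proof (cases "\<exists>H\<in>?F. sum w H = a")
      \<comment> \<open>No P4-free graph has this weight, so the restriction contains a path, and
        the second query is padding.\<close>
      case False
      then show ?thesis using cand by (intro determined_const[where c = True]) blast
    next
      case True
      then obtain H where H: "H \<in> ?F" "sum w H = a" by blast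
      have iff: "P4_below E m \<longleftrightarrow> E \<inter> ?U \<noteq> H" if "E \<in> ?X" for E
        using cand[OF that] inj_onD[OF w(1), of "E \<inter> ?U" H] H that X P4_free_restrict[of n E m]
        by auto
      have "determined b 1 ?X (\<lambda>E. E \<inter> ?U = H)"
        using H X by (intro determined_eq_graph[OF b]) (auto simp: P4_free_graphs_def)
      then have "determined b (1 + 0) ?X (\<lambda>E. P4_below E m)"
      proof (rule determined_bind)
        show "determined b 0 {E\<in>?X. (E \<inter> ?U = H) = c} (\<lambda>E. P4_below E m)" for c
          using iff by (intro determined_const[where c = "\<not> c"]) blast
      qed
      then show ?thesis by simp
    qed
  qed
  then show ?thesis
    using w(2) X by (simp only: numeral_2_eq_2 One_nat_def determined.simps(2)) blast
qed

text \<open>The value is \<open>n\<close> if there is no induced path at all.\<close>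

definition P4_threshold :: "nat \<Rightarrow> nat set set \<Rightarrow> nat" where
  "P4_threshold n E = (LEAST m. P4_below E m \<or> m = n)"

text \<open>Rests on the monotonicity of \<open>P4_below E\<close>; it turns each comparison of the
  binary search into one test.\<close>

lemma P4_threshold_le_iff: "P4_threshold n E \<le> m \<longleftrightarrow> P4_below E m \<or> n \<le> m"
proof
  let ?t = "P4_threshold n E"
  have "P4_below E ?t \<or> ?t = n"
    unfolding P4_threshold_def by (rule LeastI[of _ n]) simp
  moreover assume "?t \<le> m"
  moreover from this have "P4_below E m" if "P4_below E ?t"
    using that unfolding P4_below_def by (meson lessThan_subset_iff order_trans)
  ultimately show "P4_below E m \<or> n \<le> m" by auto
next
  assume "P4_below E m \<or> n \<le> m"
  then show "P4_threshold n E \<le> m"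
    unfolding P4_threshold_def
    using Least_le[of "\<lambda>m. P4_below E m \<or> m = n" m] Least_le[of "\<lambda>m. P4_below E m \<or> m = n" n]
    by auto
qed

text \<open>Binary search: each of the \<open>k\<close> halvings of the interval costs one test,
  that is two queries.\<close>

lemma determined_P4_threshold:
  assumes "enough_bits n b"
    and "\<And>E. E \<in> X \<Longrightarrow> valid_graph n E \<and> lo \<le> P4_threshold n E \<and> P4_threshold n E < lo + 2 ^ k"
  shows "determined b (2 * k) X (P4_threshold n)"
  using assms(2)
proof (induction k arbitrary: X lo)
  case 0
  then have "\<And>E. E \<in> X \<Longrightarrow> P4_threshold n E = lo" by fastforce
  then show ?case by (rule determined_const)
next
  case (Suc k)
  \<comment> \<open>The last value in the lower half of the interval.\<close>
  define m where "m = lo + 2 ^ k - 1"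
  have m: "lo + 2 ^ k = Suc m" unfolding m_def by simp
  have "determined b (2 + 2 * k) X (P4_threshold n)"
  proof (rule determined_bind)
    show "determined b 2 X (\<lambda>E. P4_below E m)"
      using Suc.prems by (intro determined_P4_below[OF assms(1)]) blast
    show "determined b (2 * k) {E\<in>X. P4_below E m = c} (P4_threshold n)" for c
    \<comment> \<open>If \<open>n \<le> m\<close>, the threshold lies in the lower half whatever the
      test says.\<close>
    proof (cases "c \<or> n \<le> m")
      case True
      show ?thesis
      proof (rule Suc.IH[of _ lo])
        fix E assume E: "E \<in> {E\<in>X. P4_below E m = c}"
        then have "P4_threshold n E \<le> m"
          using True P4_threshold_le_iff by blast
        then show "valid_graph n E \<and> lo \<le> P4_threshold n E \<and> P4_threshold n E < lo + 2 ^ k"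
          using E Suc.prems m by auto
      qed
    next
      case False
      show ?thesis
      proof (rule Suc.IH[of _ "lo + 2 ^ k"])
        fix E assume E: "E \<in> {E\<in>X. P4_below E m = c}"
        then have "\<not> P4_threshold n E \<le> m"
          using False P4_threshold_le_iff by blast
        then show "valid_graph n E \<and> lo + 2 ^ k \<le> P4_threshold n E \<and>
            P4_threshold n E < lo + 2 ^ k + 2 ^ k"
          using E Suc.prems[of E] m by auto
      qed
    qed
  qed
  then show ?case by simp
qed

section \<open>Reading off a path at the threshold\<close>

definition find_P4 :: "nat set set \<Rightarrow> nat set option" where
  "find_P4 E = (if \<exists>W. induced_P4 E W then Some (SOME W. induced_P4 E W) else None)"

lemma graph_edges_Suc:
  "graph_edges (Suc m) = graph_edges m \<union> {e\<in>graph_edges (Suc m). m \<in> e}"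
  unfolding graph_edges_def by (auto simp: less_Suc_eq)

lemma card_star_subsets: "card (Pow {e\<in>graph_edges (Suc m). m \<in> e}) \<le> 2 ^ m"
proof -
  have "{e\<in>graph_edges (Suc m). m \<in> e} \<subseteq> (\<lambda>u. {u, m}) ` {..<m}"
  proof
    fix e assume e: "e \<in> {e\<in>graph_edges (Suc m). m \<in> e}"
    then obtain a b where ab: "e = {a, b}" "a \<noteq> b"
      unfolding graph_edges_def by (auto simp: card_2_iff)
    then have "a < Suc m" "b < Suc m" "a = m \<or> b = m"
      using e unfolding graph_edges_def by auto
    then show "e \<in> (\<lambda>u. {u, m}) ` {..<m}"
      using ab by (auto simp: insert_commute)
  qed
  then have "card {e\<in>graph_edges (Suc m). m \<in> e} \<le> card {..<m}"
    by (meson surj_card_le finite_lessThan)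
  then show ?thesis
    using finite_graph_edges by (simp add: card_Pow power_increasing)
qed

text \<open>Once the threshold \<open>Suc m\<close> is known, two queries suffice: one for the
  P4-free graph on the first \<open>m\<close> vertices and one for the star of edges from
  \<open>m\<close> to them, which has at most \<open>2 ^ m\<close> subsets.\<close>

lemma determined_find_P4:
  assumes b: "enough_bits n b" and n: "n > 0" "n < 2 ^ k"
  shows "determined b (2 * k + 2) {E. valid_graph n E}
           (\<lambda>E. find_P4 (E \<inter> graph_edges (P4_threshold n E)))"
    (is "determined b _ ?X ?f")
proof (rule determined_bind)
  have "P4_threshold n E < 2 ^ k" for E
    using P4_threshold_le_iff[of n E n] n(2) by auto
  then show "determined b (2 * k) ?X (P4_threshold n)"
    by (intro determined_P4_threshold[OF b, of _ 0]) auto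
next
  fix t
  let ?Y = "{E\<in>?X. P4_threshold n E = t}"
  show "determined b 2 ?Y ?f"
  proof (cases "t > 0 \<and> t \<le> n")
    \<comment> \<open>No input has such a threshold: it is at most \<open>n\<close>, and it is
      positive because \<open>n > 0\<close> and no path fits into zero vertices.\<close>
    case False
    have "E \<notin> ?Y" if "t = 0" for E
      using that P4_threshold_le_iff[of n E 0] n(1)
      by (auto simp: P4_below_def induced_P4_def)
    moreover have "E \<notin> ?Y" if "\<not> t \<le> n" for E
      using that P4_threshold_le_iff[of n E n] by auto
    ultimately show ?thesis using False by (intro determined_const) blast
  next
    case True
    then obtain m where m: "t = Suc m" by (cases t) auto
    let ?U = "graph_edges m" and ?S = "{e\<in>graph_edges (Suc m). m \<in> e}"
    have "determined b (1 + (1 + 0)) ?Y ?f"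
    proof (intro determined_bind)
      show "determined b 1 ?Y (\<lambda>E. E \<inter> ?U)"
      proof (rule determined_restriction)
        show "finite (P4_free_graphs n)" "P4_free_graphs n \<subseteq> Pow (graph_edges n)"
          using finite_P4_free_graphs by (auto simp: P4_free_graphs_def valid_graph_def)
        show "n\<^sup>2 * (card (P4_free_graphs n))\<^sup>2 < 2 ^ b" using b unfolding enough_bits_def by blast
        fix E assume E: "E \<in> ?Y"
        then show "valid_graph n E" by blast
        have "\<not> P4_below E m" using E m P4_threshold_le_iff[of n E m] by auto
        then show "E \<inter> ?U \<in> P4_free_graphs n" using E P4_free_restrict by blast
      qed
      show "determined b 1 {E\<in>?Y. E \<inter> ?U = H} (\<lambda>E. E \<inter> ?S)" for H
      proof (rule determined_restriction)
        show "finite (Pow ?S)" using finite_graph_edges by simp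
        show "Pow ?S \<subseteq> Pow (graph_edges n)"
        proof (rule Pow_mono, rule subsetI)
          fix e assume "e \<in> ?S"
          moreover have "{..<Suc m} \<subseteq> {..<n}" using True m by auto
          ultimately show "e \<in> graph_edges n"
            unfolding graph_edges_def by (simp only: mem_Collect_eq) (meson order_trans)
        qed
        have "card (Pow ?S) \<le> 2 ^ n"
          using card_star_subsets[of m] power_increasing[of m n "2::nat"] True m
          by (meson Suc_leD le_trans one_le_numeral)
        then have "n\<^sup>2 * (card (Pow ?S))\<^sup>2 \<le> n\<^sup>2 * (2 ^ n)\<^sup>2"
          by (intro mult_le_mono2 power_mono) auto
        also have "\<dots> < 2 ^ b" using b unfolding enough_bits_def by blast
        finally show "n\<^sup>2 * (card (Pow ?S))\<^sup>2 < 2 ^ b" .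
      qed auto
      show "determined b 0 {E\<in>{E\<in>?Y. E \<inter> ?U = H}. E \<inter> ?S = T} ?f" for H T
      proof (rule determined_const)
        fix E assume E: "E \<in> {E\<in>{E\<in>?Y. E \<inter> ?U = H}. E \<inter> ?S = T}"
        then have "E \<inter> graph_edges t = H \<union> T"
          using graph_edges_Suc[of m] m by auto
        then show "?f E = find_P4 (H \<union> T)" using E by simp
      qed
    qed
    then show ?thesis by (simp add: numeral_2_eq_2)
  qed
qed

text \<open>If there is no path below the threshold, the threshold is \<open>n\<close> and the
  restricted graph is \<open>E\<close> itself; otherwise a path in the restriction is one in
  \<open>E\<close>.\<close>

lemma find_P4_threshold:
  assumes "valid_graph n E"
  shows "case find_P4 (E \<inter> graph_edges (P4_threshold n E)) of
     None \<Rightarrow> \<not> (\<exists>W. induced_P4 E W) | Some W \<Rightarrow> induced_P4 E W"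
proof (cases "P4_below E (P4_threshold n E)")
  let ?E = "E \<inter> graph_edges (P4_threshold n E)"
  case True
  then have ex: "\<exists>W. induced_P4 ?E W"
    using induced_P4_restrict[OF assms] unfolding P4_below_def by blast
  then have "induced_P4 ?E (SOME W. induced_P4 ?E W)" by (rule someI_ex)
  then have "induced_P4 E (SOME W. induced_P4 ?E W)"
    using induced_P4_restrict[OF assms] by blast
  then show ?thesis using ex unfolding find_P4_def by simp
next
  case False
  have "\<not> P4_below E n"
    using False P4_threshold_le_iff[of n E "P4_threshold n E"] P4_threshold_le_iff[of n E n]
      P4_threshold_le_iff[of n E]
    by (metis le_antisym order_refl)
  moreover have "E \<inter> graph_edges n = E"
    using assms unfolding valid_graph_def by blast
  ultimately have "\<not> (\<exists>W. induced_P4 E W)"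
    using induced_P4_restrict[OF assms, of n] unfolding P4_below_def by auto
  then show ?thesis
    using induced_P4_restrict[OF assms] unfolding find_P4_def by auto
qed

lemma det_streamable_P4:
  assumes "enough_bits n b" "n > 0" "n < 2 ^ k"
  shows "det_streamable_IndSub_P4 n (2 * k + 2) ((2 * k + 2) * b)"
proof -
  obtain step out where "\<And>i e s. s < 2 ^ ((2 * k + 2) * b) \<Longrightarrow> step i e s < 2 ^ ((2 * k + 2) * b)"
    "\<And>E xs. valid_graph n E \<Longrightarrow> is_stream E xs \<Longrightarrow>
       out (run_passes step (2 * k + 2) 0 xs) = find_P4 (E \<inter> graph_edges (P4_threshold n E))"
    using determined_streamable[OF determined_find_P4[OF assms]] by blast
  then have "solves_IndSub_P4 n (2 * k + 2) ((2 * k + 2) * b) 0 step out"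
    unfolding solves_IndSub_P4_def using find_P4_threshold by auto
  then show ?thesis unfolding det_streamable_IndSub_P4_def by blast
qed

section \<open>Bit counts and the final constants\<close>

lemma enough_bits_log:
  assumes "2 \<le> n" "n \<le> 2 ^ l"
  shows "enough_bits n (2 * l + 4 * n * (l + 1) + 1)"
proof -
  \<comment> \<open>\<open>2 * l\<close> bits pay for the factor \<open>n\<^sup>2\<close>;
    \<open>4 * n * (l + 1)\<close> bits for the square of \<open>(n + 2) ^ (2 * n)\<close>, as
    \<open>n + 2 \<le> 2 ^ (l + 1)\<close>; one more bit makes the inequality strict.\<close>
  let ?b = "2 * l + 4 * n * (l + 1) + 1"
  have n2: "n\<^sup>2 \<le> 2 ^ (2 * l)"
    using power_mono[OF assms(2), of 2] by (simp add: power_mult[symmetric] mult.commute)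
  have less: "n\<^sup>2 * x < 2 ^ ?b" if "x \<le> 2 ^ (4 * n * (l + 1))" for x
  proof -
    have "n\<^sup>2 * x \<le> 2 ^ (2 * l) * 2 ^ (4 * n * (l + 1))"
      using n2 that by (rule mult_le_mono)
    also have "\<dots> < 2 ^ ?b" by (simp add: power_add)
    finally show ?thesis .
  qed
  have "card (P4_free_graphs n) \<le> (n + 2) ^ (2 * n)"
    using assms(1) by (intro card_P4_free_graphs) simp
  also have "\<dots> \<le> (2 ^ (l + 1)) ^ (2 * n)"
    using assms by (intro power_mono) auto
  finally have "(card (P4_free_graphs n))\<^sup>2 \<le> ((2 ^ (l + 1)) ^ (2 * n))\<^sup>2"
    by (rule power_mono) simp
  also have "\<dots> = 2 ^ (4 * n * (l + 1))"
    by (simp only: power_mult[symmetric]) (simp add: algebra_simps)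
  finally have 1: "(card (P4_free_graphs n))\<^sup>2 \<le> 2 ^ (4 * n * (l + 1))" .
  have 2: "(2 ^ n)\<^sup>2 \<le> (2::nat) ^ (4 * n * (l + 1))"
    by (simp only: power_mult[symmetric]) (rule power_increasing, auto)
  have "Suc (n\<^sup>2) \<le> 2 ^ (2 * l + 1)" using n2 by (simp add: Suc_le_eq le_less_trans)
  also have "\<dots> \<le> 2 ^ (4 * n * (l + 1))"
  proof (rule power_increasing)
    have "2 * l + 1 \<le> 4 * (l + 1)" by simp
    also have "\<dots> \<le> 4 * n * (l + 1)" using assms(1) by (intro mult_le_mono1) simp
    finally show "2 * l + 1 \<le> 4 * n * (l + 1)" .
  qed simp
  finally have 3: "Suc (n\<^sup>2) \<le> 2 ^ (4 * n * (l + 1))" .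
  show ?thesis unfolding enough_bits_def using less[OF 1] less[OF 2] less[OF 3] by blast
qed

theorem theorem27:
  shows "\<exists>C::real. \<exists>k::nat. \<exists>N::nat. C > 0 \<and>
    (\<forall>n \<ge> N. \<exists>p S. real p \<le> C * (log 2 (real n)) ^ 2 \<and>
                   real S \<le> C * real n * (log 2 (real n)) ^ k \<and>
                   det_streamable_IndSub_P4 n p S)"
\<comment> \<open>136 is 8 * 17, from \<open>p \<le> 8 * x\<close> and
  \<open>b \<le> 17 * (n * x)\<close> below; \<open>n \<ge> 2\<close> ensures
  \<open>x \<ge> 1\<close>.\<close>
proof (rule exI[of _ 136], rule exI[of _ 2], rule exI[of _ 2], intro conjI allI impI)
  fix n :: nat assume n: "n \<ge> 2"
  define x where "x = log 2 (real n)"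
  define l where "l = nat \<lceil>x\<rceil>"
  have x: "x \<ge> 1" unfolding x_def using n by (simp add: le_log_iff)
  have l: "x \<le> real l" "real l \<le> 2 * x" unfolding l_def using x by linarith+
  have "real n = 2 powr x" unfolding x_def using n by simp
  also have "\<dots> \<le> 2 powr real l" using l(1) by simp
  also have "\<dots> = real (2 ^ l)" by (simp add: powr_realpow)
  finally have nl: "n \<le> 2 ^ l" by (simp only: of_nat_le_iff)
  define b where "b = 2 * l + 4 * n * (l + 1) + 1"
  \<comment> \<open>Using \<open>l + 1\<close> halvings instead of \<open>l\<close> gives the strict
    bound \<open>n < 2 ^ (l + 1)\<close>, since the threshold may equal \<open>n\<close>.\<close>
  define p where "p = 2 * (l + 1) + 2"
  have p: "real p \<le> 8 * x" unfolding p_def using l x by simp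
  have "real n * real l \<le> real n * (2 * x)" "real n * 1 \<le> real n * x"
    using n l x by (auto intro!: mult_left_mono)
  moreover have "2 * x \<le> real n * x"
    using n x by (intro mult_right_mono) auto
  moreover have "real b = 2 * real l + 4 * (real n * real l) + 4 * real n + 1"
    unfolding b_def by (simp add: algebra_simps)
  ultimately have b: "real b \<le> 17 * (real n * x)" using l(2) x by linarith
  have "det_streamable_IndSub_P4 n p (p * b)"
    unfolding p_def b_def
    by (rule det_streamable_P4[OF enough_bits_log[OF n nl]]) (use n nl in auto)
  moreover have "real p \<le> 136 * x\<^sup>2"
    using p x self_le_power[of x 2] by linarith
  moreover have "real (p * b) \<le> 136 * real n * x\<^sup>2"
    using mult_mono[OF p b] x by (simp add: power2_eq_square mult_ac)
  ultimately show "\<exists>p S. real p \<le> 136 * (log 2 (real n)) ^ 2 \<and>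
      real S \<le> 136 * real n * (log 2 (real n)) ^ 2 \<and> det_streamable_IndSub_P4 n p S"
    unfolding x_def by blast
qed simp

end
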